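(* Let $p$ be an odd prime and let $a$ be a positive integer with $p^a>3$. Then $$\sum_{k=0}^{p^a-1}\binom{p^a-1}{k}\binom{2k}{k}(-1)^k\equiv 3^{p-1}\left(\frac{p^a}{3}\right)\pmod{p^2},$$ and, if moreover $p\neq 3$, $$\sum_{k=0}^{p^a-1}\binom{p^a-1}{k}\frac{\binom{2k}{k}}{(-3)^k}\equiv\left(\frac{p^a}{3}\right)\pmod{p^2}.$$
   Context: Congruences modulo $p^2$ between rational numbers with denominators prime to $p$ are taken in the ring $\mathbb{Z}_p$ of $p$-adic integers. $(-)$ denotes the Jacobi symbol (so $\left(\frac{p^a}{3}\right)=0$ when $p=3$). *)

theory Defs
  imports "HOL-Number_Theory.Number_Theory"
begin

text \<open>
  The Jacobi symbol, meaningful for odd positive \<open>n\<close>: the product of the Legendre symbols over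
  the prime factors of \<open>n\<close>, counted with multiplicity.
\<close>

definition Jacobi :: "int \<Rightarrow> int \<Rightarrow> int" where
  "Jacobi a n = (\<Prod>q\<in>#prime_factorization n. Legendre a q)"

text \<open>
  For a prime \<open>p\<close>, the rationals with a denominator prime to \<open>p\<close> are exactly the rationals that
  lie in the ring of \<open>p\<close>-adic integers.
\<close>

definition padic_integral :: "nat \<Rightarrow> rat set" where
  "padic_integral p = {of_int a / of_int b | a b. \<not> int p dvd b}"

text \<open>
  Congruence modulo \<open>p ^ m\<close> in the ring of \<open>p\<close>-adic integers, between rationals. If \<open>z\<close> is a
  \<open>p\<close>-adic integer with \<open>x - y = p ^ m * z\<close>, then \<open>z\<close> is rational, so it is enough to let \<open>z\<close>
  range over the rational \<open>p\<close>-adic integers.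
\<close>

definition padic_cong :: "nat \<Rightarrow> nat \<Rightarrow> rat \<Rightarrow> rat \<Rightarrow> bool" where
  "padic_cong p m x y \<longleftrightarrow>
     x \<in> padic_integral p \<and> y \<in> padic_integral p \<and>
     (\<exists>z\<in>padic_integral p. x - y = of_nat p ^ m * z)"

end

theory Submission
  imports Defs "HOL-Computational_Algebra.Polynomial"
begin

text \<open>
  Put \<open>f = 1 + x + x\<^sup>2\<close>, \<open>q = p ^ a\<close> and let \<open>T\<close> be the coefficient of \<open>x ^ (q - 1)\<close> in
  \<open>g = f ^ (q - 1)\<close>. Since \<open>(2 k choose k)\<close> is the middle coefficient of \<open>(1 + x) ^ (2 k)\<close>, the
  binomial theorem turns the first sum into \<open>T\<close> and the second one into \<open>T / 3 ^ (q - 1)\<close>; by Euler's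
  theorem \<open>3 ^ (q - 1)\<close> is \<open>3 ^ (p - 1)\<close> modulo \<open>p\<^sup>2\<close> if \<open>p \<noteq> 3\<close>.

  Let \<open>A i\<close> be the coefficients of \<open>f ^ q = f g\<close>. The sum of the coefficients of \<open>g\<close> up to \<open>m\<close> is
  the sum of the \<open>A i\<close> with \<open>i \<le> m\<close> and \<open>i \<equiv> m\<close> modulo 3, while the symmetry of \<open>g\<close> expresses \<open>T\<close>
  through \<open>g(1) = 3 ^ (q - 1)\<close> and such a partial sum with \<open>m = q - 1\<close> or \<open>m = q - 2\<close>. Choosing \<open>m\<close>
  so that \<open>m \<equiv> - q\<close> modulo 3, the indices \<open>i\<close> are permuted by \<open>i \<mapsto> q - i\<close>. Comparing
  coefficients in \<open>(f ^ q)' = q f' g\<close> gives \<open>i A i = q B i\<close> with \<open>B i \<equiv> 1\<close> modulo \<open>p\<close>, so that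
  \<open>A i + A (q - i) \<equiv> 0\<close> modulo \<open>p\<^sup>2\<close>, like \<open>q / i + q / (q - i) = q\<^sup>2 / (i (q - i))\<close>. For \<open>p = 3\<close>
  already \<open>9\<close> divides \<open>A i\<close> whenever \<open>3\<close> does not divide \<open>i\<close>.
\<close>

section \<open>Both sums as coefficients of powers of quadratics\<close>

abbreviation trinomial :: "int poly" where
  "trinomial \<equiv> [:1, 1, 1:]"

text \<open>The quadratic is \<open>c * x - (1 + x)^2\<close>. In its binomial expansion the
  \<open>k\<close>-th term carries \<open>x ^ (n - k)\<close>, which leaves the coefficient of
  \<open>x ^ k\<close> in \<open>(1 + x) ^ (2 * k)\<close>. Below, \<open>c = 1\<close> yields
  \<open>- trinomial\<close> and \<open>c = 3\<close> yields \<open>- trinomial\<close> at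
  \<open>-x\<close>.\<close>

lemma sum_choose_central_binomial:
  fixes c :: int
  shows "(\<Sum>k\<le>n. int (n choose k) * int ((2 * k) choose k) * (-1) ^ k * c ^ (n - k))
    = coeff ([:-1, c - 2, -1:] ^ n) n"
proof -
  have "[:-1, c - 2, -1:] ^ n = (- ([:1, 1:] ^ 2) + monom c 1) ^ n"
    by (simp add: power2_eq_square monom_altdef)
  also have "\<dots> = (\<Sum>k\<le>n. of_nat (n choose k) * (- ([:1, 1:] ^ 2)) ^ k * monom c 1 ^ (n - k))"
    by (rule binomial_ring)
  also have "coeff \<dots> n = (\<Sum>k\<le>n. int (n choose k) * int ((2 * k) choose k) * (-1) ^ k * c ^ (n - k))"
    unfolding coeff_sum
  proof (rule sum.cong[OF refl])
    fix k assume "k \<in> {..n}"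
    then have k: "k \<le> n" "n - (n - k) = k" by auto
    have "(- ([:1, 1 :: int:] ^ 2)) ^ k = smult ((-1) ^ k) ([:1, 1:] ^ (2 * k))"
      by (simp add: power_minus[of "[:1, 1:] ^ 2"] power_mult minus_one_power_iff)
    moreover have "monom c 1 ^ (n - k) = monom (c ^ (n - k)) (n - k)"
      by (simp add: monom_power)
    ultimately have "of_nat (n choose k) * (- ([:1, 1:] ^ 2)) ^ k * monom c 1 ^ (n - k)
        = smult (int (n choose k) * (-1) ^ k) (monom (c ^ (n - k)) (n - k) * [:1, 1:] ^ (2 * k))"
      by (simp add: of_nat_poly mult.commute)
    then show "coeff (of_nat (n choose k) * (- ([:1, 1:] ^ 2)) ^ k * monom c 1 ^ (n - k)) n
        = int (n choose k) * int ((2 * k) choose k) * (-1) ^ k * c ^ (n - k)"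
      using k by (simp add: coeff_monom_mult coeff_linear_poly_power)
  qed
  finally show ?thesis by simp
qed

section \<open>Partial sums of coefficients\<close>

lemma coeff_trinomial_mult:
  "coeff (trinomial * h) 0 = coeff h 0"
  "coeff (trinomial * h) (Suc 0) = coeff h 1 + coeff h 0"
  "coeff (trinomial * h) (Suc (Suc n)) = coeff h (Suc (Suc n)) + coeff h (Suc n) + coeff h n"
  by (simp_all add: coeff_pCons)

text \<open>A coefficient of \<open>trinomial * h\<close> adds three consecutive coefficients of
  \<open>h\<close>. The blocks ending at \<open>m\<close>, \<open>m - 3\<close>, ... tile the range,
  the last one being cut off at 0; hence an induction in steps of 3.\<close>

lemma sum_coeff_eq_sum_trinomial_mult:
  "(\<Sum>j\<le>m. coeff h j) = (\<Sum>i | i \<le> m \<and> [i = m] (mod 3). coeff (trinomial * h) i)"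
proof (induction m rule: less_induct)
  case (less m)
  consider "m = 0" | "m = 1" | "m = 2" | n where "m = Suc (Suc (Suc n))"
    by (metis One_nat_def Suc_1 old.nat.exhaust)
  then show ?case
  proof cases
    case 1
    then have "{i. i \<le> m \<and> [i = m] (mod 3)} = {0}" by auto
    with 1 show ?thesis by (simp add: coeff_trinomial_mult)
  next
    case 2
    then have "{i. i \<le> m \<and> [i = m] (mod 3)} = {1}"
      by (auto simp: cong_def le_Suc_eq)
    with 2 show ?thesis by (simp add: coeff_trinomial_mult)
  next
    case 3
    then have "{i. i \<le> m \<and> [i = m] (mod 3)} = {2}"
      by (auto simp: cong_def le_Suc_eq numeral_2_eq_2)
    with 3 show ?thesis by (simp add: coeff_trinomial_mult numeral_2_eq_2)
  next
    case (4 n)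
    have "m mod 3 = n mod 3" "Suc n mod 3 \<noteq> n mod 3" "Suc (Suc n) mod 3 \<noteq> n mod 3"
      using mod_add_self2[of n 3] by (auto simp: 4 mod_Suc)
    then have "i \<le> m \<and> i mod 3 = m mod 3 \<longleftrightarrow> i = m \<or> i \<le> n \<and> i mod 3 = n mod 3" for i
      unfolding 4 by (metis le_Suc_eq)
    then have "{i. i \<le> m \<and> [i = m] (mod 3)} = insert m {i. i \<le> n \<and> [i = n] (mod 3)}"
      unfolding cong_def by blast
    with 4 less.IH[of n] show ?thesis by (simp add: coeff_trinomial_mult)
  qed
qed

lemma degree_trinomial_power: "degree (trinomial ^ n) = 2 * n"
  by (simp add: degree_power_eq)

lemma coeff_trinomial_power_symmetric:
  assumes "i \<le> 2 * n"
  shows "coeff (trinomial ^ n) (2 * n - i) = coeff (trinomial ^ n) i"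
proof -
  have "reflect_poly trinomial = trinomial"
    by (simp add: reflect_poly_def cCons_def)
  then have "reflect_poly (trinomial ^ n) = trinomial ^ n"
    by (simp only: reflect_poly_power)
  from arg_cong[OF this, of "\<lambda>h. coeff h i"] show ?thesis
    using assms by (simp add: coeff_reflect_poly degree_trinomial_power)
qed

lemma sum_coeff_trinomial_power: "(\<Sum>j\<le>2 * n. coeff (trinomial ^ n) j) = 3 ^ n"
  using poly_altdef[of "trinomial ^ n" 1] by (simp add: degree_trinomial_power)

lemma twice_sum_coeff_trinomial_power:
  "2 * (\<Sum>j<n. coeff (trinomial ^ n) j) + coeff (trinomial ^ n) n = 3 ^ n"
proof -
  let ?c = "coeff (trinomial ^ n)"
  have "(\<Sum>j\<in>{n<..2 * n}. ?c j) = (\<Sum>j<n. ?c j)"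
    by (rule sum.reindex_bij_witness[of _ "\<lambda>j. 2 * n - j" "\<lambda>j. 2 * n - j"])
      (auto simp: coeff_trinomial_power_symmetric)
  moreover have "{..2 * n} = insert n {..<n} \<union> {n<..2 * n}" by auto
  then have "(\<Sum>j\<le>2 * n. ?c j) = (\<Sum>j\<in>insert n {..<n}. ?c j) + (\<Sum>j\<in>{n<..2 * n}. ?c j)"
    by (simp only:) (rule sum.union_disjoint, auto)
  ultimately show ?thesis using sum_coeff_trinomial_power[of n] by simp
qed

section \<open>Coefficients of \<open>trinomial ^ (p ^ a)\<close> modulo \<open>p\<close> and
  \<open>p ^ 2\<close>\<close>

lemma mult_coeff_trinomial_power:
  "int (Suc i) * coeff (trinomial ^ Suc n) (Suc i)
    = int (Suc n) * coeff ([:1, 2:] * trinomial ^ n) i"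
proof -
  have "int (Suc i) * coeff (trinomial ^ Suc n) (Suc i) = coeff (pderiv (trinomial ^ Suc n)) i"
    by (simp only: coeff_pderiv of_nat_Suc)
  also have "pderiv (trinomial ^ Suc n) = smult (int (Suc n)) ([:1, 2:] * trinomial ^ n)"
    by (simp only: pderiv_power_Suc) (simp add: pderiv_pCons mult.commute)
  finally show ?thesis by simp
qed

lemma prime_dvd_of_prime_power_dvd_mult:
  fixes p a i :: nat and x :: int
  assumes "prime p" "0 < i" "i < p ^ a" "int (p ^ a) dvd int i * x"
  shows "int p dvd x"
proof (rule ccontr)
  assume "\<not> int p dvd x"
  with assms have "coprime (int (p ^ a)) x"
    by (simp add: prime_imp_coprime)
  with assms have "p ^ a dvd i"
    by (metis coprime_dvd_mult_left_iff int_dvd_int_iff)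
  with assms show False by (simp add: nat_dvd_not_less)
qed

lemma prime_dvd_coeff_trinomial_power:
  assumes "prime p" "0 < i" "i < p ^ a"
  shows "int p dvd coeff (trinomial ^ (p ^ a)) i"
proof -
  obtain j n where "i = Suc j" "p ^ a = Suc n"
    using assms by (metis gr0_conv_Suc less_trans)
  with mult_coeff_trinomial_power[of j n] assms show ?thesis
    by (intro prime_dvd_of_prime_power_dvd_mult[of p i a]) (auto simp del: power_Suc)
qed

text \<open>Modulo \<open>p\<close>, the product \<open>trinomial * trinomial ^ n\<close> is 1 up to
  degree \<open>n\<close>, so \<open>trinomial ^ n\<close> agrees there with
  \<open>1 / trinomial = (1 - x) / (1 - x^3)\<close>.\<close>

lemma coeff_trinomial_power_pred_cong:
  assumes "prime p" "p ^ a = Suc n" "j \<le> n"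
  shows "[coeff (trinomial ^ n) j = (if j mod 3 = 0 then 1 else if j mod 3 = 1 then -1 else 0)]
    (mod int p)"
  using assms(3)
proof (induction j rule: less_induct)
  case (less j)
  let ?g = "coeff (trinomial ^ n)"
  have A: "[coeff (trinomial * trinomial ^ n) j = 0] (mod int p)" if "0 < j"
    using prime_dvd_coeff_trinomial_power[of p j a] that less.prems assms
    by (simp add: cong_0_iff)
  consider "j = 0" | "j = 1" | k where "j = Suc (Suc k)"
    by (metis One_nat_def old.nat.exhaust)
  then show ?case
  proof cases
    case 1
    have "?g 0 = 1" by (induction n) (simp_all add: coeff_mult)
    with 1 show ?thesis by simp
  next
    case 2
    have "?g 0 = 1" by (induction n) (simp_all add: coeff_mult)
    with 2 A show ?thesis
      by (simp add: coeff_trinomial_mult cong_iff_dvd_diff)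
  next
    case (3 k)
    let ?c = "\<lambda>j. (if j mod 3 = 0 then 1 else if j mod 3 = 1 then -1 else 0) :: int"
    have "int p dvd ?g j + ?g (Suc k) + ?g k"
      using A 3 by (simp add: coeff_trinomial_mult cong_0_iff add.assoc)
    moreover have "int p dvd ?g (Suc k) - ?c (Suc k)" "int p dvd ?g k - ?c k"
      using less.IH[of k] less.IH[of "Suc k"] less.prems 3
      by (simp_all only: cong_iff_dvd_diff)
    ultimately have "int p dvd (?g j + ?g (Suc k) + ?g k) - (?g (Suc k) - ?c (Suc k)) - (?g k - ?c k)"
      by (metis dvd_diff)
    moreover have "?c j + ?c (Suc k) + ?c k = 0"
    proof -
      consider "k mod 3 = 0" | "k mod 3 = 1" | "k mod 3 = 2" by linarith
      then show ?thesis unfolding 3 by cases (simp_all add: mod_Suc)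
    qed
    then have "(?g j + ?g (Suc k) + ?g k) - (?g (Suc k) - ?c (Suc k)) - (?g k - ?c k) = ?g j - ?c j"
      by linarith
    ultimately show ?thesis by (simp only: cong_iff_dvd_diff)
  qed
qed

text \<open>The logarithmic derivative of \<open>trinomial\<close> is
  \<open>(1 + x - 2 x^2) / (1 - x^3)\<close>; only its coefficients at \<open>i = 2\<close> modulo 3
  differ from 1.\<close>

lemma coeff_deriv_trinomial_cong:
  assumes "prime p" "p ^ a = Suc n" "i \<le> n" "\<not> 3 dvd Suc i"
  shows "[coeff ([:1, 2:] * trinomial ^ n) i = 1] (mod int p)"
proof (cases i)
  case 0
  then show ?thesis using coeff_trinomial_power_pred_cong[OF assms(1,2), of 0] by simp
next
  case (Suc k)
  have "coeff ([:1, 2:] * trinomial ^ n) i = coeff (trinomial ^ n) i + 2 * coeff (trinomial ^ n) k"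
    by (simp add: Suc coeff_pCons)
  moreover have "[coeff (trinomial ^ n) i + 2 * coeff (trinomial ^ n) k =
      (if i mod 3 = 0 then 1 else if i mod 3 = 1 then -1 else 0)
      + 2 * (if k mod 3 = 0 then 1 else if k mod 3 = 1 then -1 else 0)] (mod int p)"
    using assms Suc
    by (intro cong_add cong_mult cong_refl coeff_trinomial_power_pred_cong) auto
  moreover have "(if i mod 3 = 0 then 1 else if i mod 3 = 1 then -1 else 0)
      + 2 * (if k mod 3 = 0 then 1 else if k mod 3 = 1 then -1 else 0) = (1 :: int)"
  proof -
    have "k mod 3 = 0 \<or> k mod 3 = 2"
      using assms(4) unfolding Suc by presburger
    then show ?thesis unfolding Suc by (auto simp: mod_Suc)
  qed
  ultimately show ?thesis by simp
qed

lemma coeff_trinomial_power_prime_multiple: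
  assumes p: "prime p" and i: "i = p ^ v * k" "0 < i" "i < p ^ a" "\<not> 3 dvd i" and b: "a = v + Suc b"
  obtains B where "int k * coeff (trinomial ^ (p ^ a)) i = int p ^ Suc b * B" "int p dvd B - 1"
proof -
  obtain j where j: "i = Suc j" using i(2) gr0_conv_Suc by blast
  obtain n where n: "p ^ a = Suc n" using i(2,3) by (metis gr0_conv_Suc less_trans)
  let ?B = "coeff ([:1, 2:] * trinomial ^ n) j"
  have "int i * coeff (trinomial ^ (p ^ a)) i = int (p ^ a) * ?B"
    unfolding j n by (rule mult_coeff_trinomial_power)
  moreover have "int i = int (p ^ v) * int k" "int (p ^ a) = int (p ^ v) * int p ^ Suc b"
    by (simp_all add: i(1) b power_add)
  ultimately have "int (p ^ v) * (int k * coeff (trinomial ^ (p ^ a)) i)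
      = int (p ^ v) * (int p ^ Suc b * ?B)"
    by (simp only: mult.assoc)
  moreover have "int (p ^ v) \<noteq> 0" using p by auto
  ultimately have "int k * coeff (trinomial ^ (p ^ a)) i = int p ^ Suc b * ?B"
    using mult_left_cancel by blast
  moreover have "j \<le> n" using i(3) j n by simp
  then have "int p dvd ?B - 1"
    using coeff_deriv_trinomial_cong[OF p n] i(4) by (simp only: j cong_iff_dvd_diff)
  ultimately show ?thesis by (rule that)
qed

text \<open>Since \<open>v < a\<close>, both \<open>i\<close> and \<open>p ^ a - i\<close> have
  \<open>p\<close>-adic valuation \<open>v\<close>, and their cofactors \<open>m\<close>,
  \<open>m'\<close> add up to \<open>p ^ Suc b\<close>. Multiplying by \<open>m * m'\<close>, which
  is prime to \<open>p\<close>, clears the denominators in \<open>1 / m + 1 / m'\<close>.\<close>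

lemma coeff_trinomial_power_antisymmetric:
  assumes p: "prime p" and i: "0 < i" "i < p ^ a" "\<not> 3 dvd i" "\<not> 3 dvd p ^ a - i"
  shows "int p ^ 2 dvd coeff (trinomial ^ (p ^ a)) i + coeff (trinomial ^ (p ^ a)) (p ^ a - i)"
proof -
  define v where "v = multiplicity p i"
  obtain m where m: "i = p ^ v * m" "\<not> p dvd m"
    using i(1) p unfolding v_def
    by (metis gr_implies_not0 multiplicity_decompose' not_prime_unit)
  have "p ^ v \<le> i" using m i(1) by simp
  with i(2) have "p ^ v < p ^ a" by simp
  then have "v < a" using p by (metis power_less_imp_less_exp prime_gt_1_nat)
  then obtain b where b: "a = v + Suc b" using less_imp_Suc_add by auto
  define m' where "m' = p ^ Suc b - m"
  have pv: "p ^ v > 0" using p by (simp add: prime_gt_0_nat)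
  have mm': "m + m' = p ^ Suc b"
    using i(2) m(1) b pv by (simp add: m'_def power_add)
  have m': "p ^ a - i = p ^ v * m'"
    by (simp add: b m(1) m'_def power_add diff_mult_distrib2 mult_ac)
  have "\<not> p dvd m'"
    using mm' m(2) by (metis dvd_add_left_iff dvd_triv_left power_Suc)
  let ?A = "coeff (trinomial ^ (p ^ a))"
  obtain B where B: "int m * ?A i = int p ^ Suc b * B" "int p dvd B - 1"
    using coeff_trinomial_power_prime_multiple[OF p m(1) i(1,2,3) b] by blast
  obtain B' where B': "int m' * ?A (p ^ a - i) = int p ^ Suc b * B'" "int p dvd B' - 1"
  proof (rule coeff_trinomial_power_prime_multiple[OF p m' _ _ i(4) b])
    show "0 < p ^ a - i" "p ^ a - i < p ^ a" using i(1,2) by auto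
  qed blast
  have "int m * int m' * (?A i + ?A (p ^ a - i))
      = int m' * (int m * ?A i) + int m * (int m' * ?A (p ^ a - i))"
    by (simp add: algebra_simps)
  also have "\<dots> = int p ^ Suc b * (int m' * (B - 1) + int m * (B' - 1) + int (m + m'))"
    unfolding B B' by (simp add: algebra_simps)
  finally have "int m * int m' * (?A i + ?A (p ^ a - i))
      = int p ^ Suc b * (int m' * (B - 1) + int m * (B' - 1) + int (m + m'))" .
  \<comment> \<open>One factor \<open>p\<close> comes from \<open>p ^ Suc b\<close>, the other from
    the bracket: \<open>B\<close> and \<open>B'\<close> are 1 modulo \<open>p\<close>, and
    \<open>p\<close> divides \<open>m + m'\<close>.\<close>
  moreover have "int p * int p dvd int p ^ Suc b *
      (int m' * (B - 1) + int m * (B' - 1) + int (m + m'))"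
    using B B' mm' by (intro mult_dvd_mono dvd_add dvd_mult) auto
  ultimately have "int p ^ 2 dvd int m * int m' * (?A i + ?A (p ^ a - i))"
    by (simp add: power2_eq_square)
  moreover have "coprime (int p ^ 2) (int m * int m')"
    using p m(2) \<open>\<not> p dvd m'\<close> by (simp add: prime_imp_coprime)
  ultimately show ?thesis by (simp add: coprime_dvd_mult_right_iff)
qed

text \<open>The hypotheses unify \<open>m = p ^ a - 1\<close> (\<open>m mod 3 = 1\<close>) and
  \<open>m = p ^ a - 2\<close> (\<open>m mod 3 = 2\<close>). In both cases \<open>2 * m\<close> is
  \<open>p ^ a\<close> modulo 3, so reflection \<open>i |-> p ^ a - i\<close> permutes the class of
  \<open>m\<close>, and doubling the sum pairs its terms.\<close>

lemma sum_coeff_trinomial_power_class: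
  assumes p: "prime p" and q: "p ^ a = m + m mod 3" and m: "m mod 3 \<noteq> 0"
  shows "int p ^ 2 dvd 2 * (\<Sum>j\<le>m. coeff (trinomial ^ (p ^ a - 1)) j)"
proof -
  let ?A = "coeff (trinomial ^ (p ^ a))"
  let ?I = "{i. i \<le> m \<and> [i = m] (mod 3)}"
  obtain n where n: "p ^ a = Suc n" using q m by (metis add_is_0 gr0_conv_Suc gr0I)
  have I: "0 < i \<and> i < p ^ a \<and> \<not> 3 dvd i \<and> p ^ a - i \<in> ?I" if "i \<in> ?I" for i
  proof -
    from that have i: "i \<le> m" "i mod 3 = m mod 3" by (simp_all add: cong_def)
    then obtain d where d: "m = i + 3 * d" by (metis mod_eq_nat2E)
    have "p ^ a - i = m mod 3 + 3 * d" using q d by simp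
    \<comment> \<open>As \<open>p ^ a - m\<close> is \<open>m mod 3\<close>, the least index of the
      class, the reflected index is at most \<open>m\<close>.\<close>
    moreover have "m mod 3 \<le> i" using i(2) by (metis mod_less_eq_dividend)
    ultimately have "p ^ a - i \<in> ?I" using d by (simp add: cong_def)
    moreover have "\<not> 3 dvd i" using i m by (simp add: dvd_eq_mod_eq_0)
    ultimately show ?thesis using i q m by (auto intro: gr0I)
  qed
  have "(\<Sum>i\<in>?I. ?A i) = (\<Sum>i\<in>?I. ?A (p ^ a - i))"
    by (rule sum.reindex_bij_witness[of _ "\<lambda>i. p ^ a - i" "\<lambda>i. p ^ a - i"])
      (use I in force)+
  then have "2 * (\<Sum>i\<in>?I. ?A i) = (\<Sum>i\<in>?I. ?A i + ?A (p ^ a - i))"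
    by (simp add: sum.distrib)
  moreover have "int p ^ 2 dvd \<dots>"
    using I by (intro dvd_sum coeff_trinomial_power_antisymmetric p) blast+
  ultimately show ?thesis
    using sum_coeff_eq_sum_trinomial_mult[of "trinomial ^ n" m] by (simp add: n)
qed

section \<open>The central coefficient and powers modulo \<open>p ^ 2\<close>\<close>

lemma Jacobi_3: "Jacobi x 3 = (if x mod 3 = 0 then 0 else if x mod 3 = 1 then 1 else -1)"
proof -
  have "Jacobi x 3 = Legendre x 3"
    by (simp add: Jacobi_def prime_factorization_prime)
  moreover have "QuadRes 3 x" if "x mod 3 = 1"
    unfolding QuadRes_def using that by (intro exI[of _ 1]) (simp add: cong_def)
  moreover have "\<not> QuadRes 3 x" if "x mod 3 = 2"
  proof
    assume "QuadRes 3 x"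
    then obtain y where "[y ^ 2 = x] (mod 3)" by (auto simp: QuadRes_def)
    then have "(y mod 3) ^ 2 mod 3 = 2" using that by (simp add: cong_def power_mod)
    moreover have "y mod 3 = 0 \<or> y mod 3 = 1 \<or> y mod 3 = 2" by presburger
    ultimately show False by auto
  qed
  moreover have "x mod 3 = 0 \<or> x mod 3 = 1 \<or> x mod 3 = 2" by presburger
  ultimately show ?thesis by (auto simp: Legendre_def cong_def)
qed

lemma central_trinomial_cong:
  fixes p a :: nat
  assumes p: "prime p" and a: "p ^ a > 3"
  shows "[coeff (trinomial ^ (p ^ a - 1)) (p ^ a - 1)
      = 3 ^ (p ^ a - 1) * Jacobi (int (p ^ a)) 3] (mod int p ^ 2)"
proof -
  define n where "n = p ^ a - 1"
  have n: "p ^ a = Suc n" "p ^ a - 1 = n" using a by (auto simp: n_def)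
  let ?g = "coeff (trinomial ^ n)"
  have T: "2 * (\<Sum>j<n. ?g j) + ?g n = 3 ^ n"
    by (rule twice_sum_coeff_trinomial_power)
  obtain m where m: "n = Suc m" using a n by (cases n) auto
  then have lessThan: "{..<n} = {..m}" "{..n} = insert n {..<n}" by auto
  have J: "Jacobi (int (p ^ a)) 3
      = (if p ^ a mod 3 = 0 then 0 else if p ^ a mod 3 = 1 then 1 else -1)"
    unfolding Jacobi_3 by presburger
  consider "p ^ a mod 3 = 0" | "p ^ a mod 3 = 1" | "p ^ a mod 3 = 2" by linarith
  then have "int p ^ 2 dvd ?g n - 3 ^ n * Jacobi (int (p ^ a)) 3"
  proof cases
    case 1
    then have "3 dvd p" using prime_dvd_power[of 3 p a] by auto
    then have [simp]: "p = 3" using p primes_dvd_imp_eq[of 3 p] by simp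
    \<comment> \<open>\<open>p ^ a > 3\<close> excludes \<open>a = 1\<close>. The factor 9 of
      \<open>p ^ a\<close> then passes to every coefficient with index prime to 3, and
      \<open>m = p ^ a - 2\<close> is 1 modulo 3, so its class has only such indices.\<close>
    from a have "2 \<le> a" by (cases a; cases "a - 1") auto
    then have q9: "9 dvd p ^ a" using le_imp_power_dvd[of 2 a 3] by simp
    have "9 dvd coeff (trinomial * trinomial ^ n) i" if "\<not> 3 dvd i" for i
    proof -
      obtain j where j: "i = Suc j" using \<open>\<not> 3 dvd i\<close> by (cases i) auto
      have "int 9 dvd int (Suc n)" using q9 n by (simp only: int_dvd_int_iff)
      then have "9 dvd int i * coeff (trinomial * trinomial ^ n) i"
        using mult_coeff_trinomial_power[of j n] by (simp add: j del: of_nat_Suc)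
      moreover have "coprime (3 :: int) (int i)"
        using that prime_imp_coprime[of "3::int" "int i"] int_dvd_int_iff[of 3 i] by simp
      then have "coprime ((3 :: int) ^ 2) (int i)" by (simp only: coprime_power_left_iff simp_thms)
      then have "coprime (9 :: int) (int i)" by (simp del: coprime_power_left_iff)
      ultimately show ?thesis by (simp add: coprime_dvd_mult_right_iff)
    qed
    moreover have "\<not> 3 dvd i" if "[i = m] (mod 3)" for i
    proof -
      have "m mod 3 = 1" using 1 unfolding n m by (simp add: mod_Suc split: if_splits)
      with that show ?thesis by (simp add: cong_def dvd_eq_mod_eq_0)
    qed
    ultimately have "9 dvd (\<Sum>j<n. ?g j)"
      unfolding lessThan sum_coeff_eq_sum_trinomial_mult by (intro dvd_sum) auto
    moreover have "9 dvd (3::int) ^ n"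
      using le_imp_power_dvd[of 2 n "3::int"] a n by simp
    ultimately have "9 dvd 3 ^ n - 2 * (\<Sum>j<n. ?g j)" by (intro dvd_diff dvd_mult)
    moreover have "3 ^ n - 2 * (\<Sum>j<n. ?g j) = ?g n" using T by linarith
    ultimately have "9 dvd ?g n" by (simp only:)
    moreover have "Jacobi (int (p ^ a)) 3 = 0" unfolding J using 1 by simp
    ultimately show ?thesis by simp
  next
    case 2
    \<comment> \<open>Here \<open>m = p ^ a - 2\<close>, and the sum stops just below the central
      coefficient.\<close>
    have "m mod 3 = 2" using 2 unfolding n m by (simp add: mod_Suc split: if_splits)
    then have "int p ^ 2 dvd 2 * (\<Sum>j<n. ?g j)"
      using sum_coeff_trinomial_power_class[OF p, of a m] unfolding lessThan n(2) by (simp add: n(1) m)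
    moreover have "2 * (\<Sum>j<n. ?g j) = - (?g n - 3 ^ n)" using T by linarith
    ultimately have "int p ^ 2 dvd ?g n - 3 ^ n" by (simp only: dvd_minus_iff)
    moreover have "Jacobi (int (p ^ a)) 3 = 1" unfolding J using 2 by simp
    ultimately show ?thesis by (simp only: mult_1_right)
  next
    case 3
    \<comment> \<open>Now the sum runs up to \<open>n = p ^ a - 1\<close>; including the central
      coefficient turns \<open>3 ^ n - ?g n\<close> into \<open>3 ^ n + ?g n\<close>, whence the
      sign -1.\<close>
    have "n mod 3 = 1" using 3 unfolding n by (simp add: mod_Suc split: if_splits)
    then have "int p ^ 2 dvd 2 * (\<Sum>j\<le>n. ?g j)"
      using sum_coeff_trinomial_power_class[OF p, of a n] unfolding n(2) by (simp add: n(1))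
    moreover have "2 * (\<Sum>j\<le>n. ?g j) = 3 ^ n + ?g n"
      using T by (simp add: lessThan(2))
    moreover have "Jacobi (int (p ^ a)) 3 = - 1" unfolding J using 3 by simp
    ultimately show ?thesis
      by (simp only: mult_minus1_right diff_minus_eq_add add.commute)
  qed
  then show ?thesis by (simp add: cong_iff_dvd_diff n)
qed

text \<open>\<open>p ^ a - 1\<close> exceeds \<open>p - 1\<close> by
  \<open>p * (p ^ (a - 1) - 1)\<close>, a multiple of \<open>p * (p - 1) = totient (p ^ 2)\<close>,
  so Euler's theorem applies.\<close>

lemma power_prime_power_minus_one_cong:
  fixes p a c :: nat
  assumes p: "prime p" and "a > 0" and c: "\<not> p dvd c"
  shows "[int c ^ (p ^ a - 1) = int c ^ (p - 1)] (mod int p ^ 2)"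
proof -
  obtain b where b: "a = Suc b" using assms(2) gr0_conv_Suc by blast
  have p0: "p > 0" using p by (simp add: prime_gt_0_nat)
  then have "[p = 1] (mod (p - 1))" by (subst cong_def, subst mod_eq_dvd_iff_nat) auto
  from cong_pow[OF this, of b] have "p - 1 dvd p ^ b - 1"
    by (intro cong_to_1_nat) simp
  then obtain k where k: "p ^ b - 1 = (p - 1) * k" by blast
  have "p ^ a - 1 = (p - 1) + (p * (p - 1)) * k"
  proof -
    have "p ^ a - 1 = (p - 1) + p * (p ^ b - 1)"
      using p0 by (simp add: b diff_mult_distrib2)
    then show ?thesis by (simp only: k mult.assoc)
  qed
  then have "c ^ (p ^ a - 1) = c ^ (p - 1) * (c ^ (totient (p ^ 2))) ^ k"
    using p by (simp add: power_add power_mult totient_prime_power)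
  moreover have "coprime c (p ^ 2)"
    using p c by (simp add: prime_imp_coprime coprime_commute[of c])
  then have "[c ^ totient (p ^ 2) = 1] (mod p ^ 2)" by (rule euler_theorem)
  then have "[c ^ (p - 1) * (c ^ totient (p ^ 2)) ^ k = c ^ (p - 1) * 1 ^ k] (mod p ^ 2)"
    by (intro cong_mult cong_pow cong_refl)
  ultimately have "[c ^ (p ^ a - 1) = c ^ (p - 1)] (mod p ^ 2)" by simp
  then show ?thesis by (simp flip: cong_int_iff)
qed

section \<open>The two congruences\<close>

lemma pcompose_power: "(h ^ n) \<circ>\<^sub>p r = (h \<circ>\<^sub>p r :: 'a :: comm_ring_1 poly) ^ n"
  by (induction n) (simp_all add: pcompose_mult pcompose_1)

theorem corollary1p4:
  fixes p a :: nat
  assumes "prime p" and "odd p" and "a > 0" and "p ^ a > 3"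
  shows "[(\<Sum>k = 0..p ^ a - 1. int ((p ^ a - 1) choose k) * int ((2 * k) choose k) * (-1) ^ k)
            = 3 ^ (p - 1) * Jacobi (int (p ^ a)) 3] (mod (int p ^ 2)) \<and>
         (p \<noteq> 3 \<longrightarrow>
            padic_cong p 2
              (\<Sum>k = 0..p ^ a - 1.
                 of_nat ((p ^ a - 1) choose k) * (of_nat ((2 * k) choose k) / (-3) ^ k))
              (of_int (Jacobi (int (p ^ a)) 3)))"
proof -
  define n where "n = p ^ a - 1"
  define J where "J = Jacobi (int (p ^ a)) 3"
  define T where "T = coeff (trinomial ^ n) n"
  \<comment> \<open>Evenness absorbs the sign of \<open>- trinomial\<close> and that of replacing
    \<open>x\<close> by \<open>-x\<close> in degree \<open>n\<close>.\<close>
  have "even n" using assms by (simp add: n_def)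
  have T: "[T = 3 ^ n * J] (mod int p ^ 2)"
    using central_trinomial_cong[OF assms(1,4)] by (simp add: T_def n_def J_def)
  have S1: "(\<Sum>k = 0..n. int (n choose k) * int ((2 * k) choose k) * (-1) ^ k) = T"
  proof -
    have "[:-1, 1 - 2, -1:] ^ n = (- trinomial) ^ n" by simp
    also have "\<dots> = trinomial ^ n" using \<open>even n\<close> by (simp only: power_minus_even)
    finally show ?thesis
      using sum_choose_central_binomial[of n 1] by (simp add: T_def atMost_atLeast0)
  qed
  have S2: "(\<Sum>k\<le>n. int (n choose k) * int ((2 * k) choose k) * (-1) ^ k * 3 ^ (n - k)) = T"
  proof -
    have "[:-1, 3 - 2, -1:] ^ n = (- (trinomial \<circ>\<^sub>p [:0, -1:])) ^ n"
      by (simp add: pcompose_pCons)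
    also have "\<dots> = trinomial ^ n \<circ>\<^sub>p [:0, -1:]"
      using \<open>even n\<close> by (simp only: power_minus_even) (rule pcompose_power[symmetric])
    also have "coeff \<dots> n = T"
      using \<open>even n\<close> by (simp add: coeff_pcompose_linear T_def)
    finally show ?thesis using sum_choose_central_binomial[of n 3] by simp
  qed
  have "[T = 3 ^ (p - 1) * J] (mod int p ^ 2)"
  proof (cases "p = 3")
    case True
    have "J = 0" using assms(3) by (simp add: J_def Jacobi_3 True)
    with T show ?thesis by simp
  next
    case False
    then have "\<not> p dvd 3" using assms(1) primes_dvd_imp_eq[of p 3] by auto
    then have "[3 ^ n = 3 ^ (p - 1)] (mod int p ^ 2)"
      using power_prime_power_minus_one_cong[OF assms(1,3), of 3] by (simp add: n_def)
    from cong_trans[OF T cong_mult[OF this cong_refl]] show ?thesis .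
  qed
  moreover have "padic_cong p 2
      (\<Sum>k = 0..n. of_nat (n choose k) * (of_nat ((2 * k) choose k) / (-3) ^ k)) (of_int J)"
    if "p \<noteq> 3"
  proof -
    have "\<not> p dvd 3 ^ n"
      using that assms(1) prime_dvd_power[of p 3 n] primes_dvd_imp_eq[of p 3] by auto
    then have n3: "\<not> int p dvd 3 ^ n"
      by (metis int_dvd_int_iff of_nat_numeral of_nat_power)
    have int: "of_int x \<in> padic_integral p" for x
      unfolding padic_integral_def mem_Collect_eq
      using assms(1) by (intro exI[of _ x] exI[of _ 1]) (auto simp: prime_gt_1_nat)
    have quot: "of_int x / 3 ^ n \<in> padic_integral p" for x
      unfolding padic_integral_def mem_Collect_eq
      using n3 by (intro exI[of _ x] exI[of _ "3 ^ n"]) auto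
    \<comment> \<open>With the common denominator \<open>3 ^ n\<close>, the factor
      \<open>1 / (-3) ^ k\<close> becomes \<open>(-1) ^ k * 3 ^ (n - k) / 3 ^ n\<close>, which
      matches \<open>S2\<close>.\<close>
    have "(\<Sum>k = 0..n. of_nat (n choose k) * (of_nat ((2 * k) choose k) / (-3) ^ k))
        = (\<Sum>k\<le>n. of_int (int (n choose k) * int ((2 * k) choose k) * (-1) ^ k * 3 ^ (n - k)) / 3 ^ n :: rat)"
      unfolding atMost_atLeast0
    proof (rule sum.cong[OF refl])
      fix k assume "k \<in> {0..n}"
      then have "(3 :: rat) ^ n = 3 ^ (n - k) * 3 ^ k"
        by (simp flip: power_add)
      then show "of_nat (n choose k) * (of_nat ((2 * k) choose k) / (-3) ^ k)
          = of_int (int (n choose k) * int ((2 * k) choose k) * (-1) ^ k * 3 ^ (n - k)) / (3 ^ n :: rat)"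
        by (simp add: power_minus[of "3 :: rat"] minus_one_power_iff)
    qed
    also have "\<dots> = of_int T / 3 ^ n"
      unfolding S2[symmetric] by (simp add: sum_divide_distrib)
    finally have sum: "(\<Sum>k = 0..n. of_nat (n choose k) * (of_nat ((2 * k) choose k) / (-3) ^ k))
        = (of_int T / 3 ^ n :: rat)" .
    obtain z where "T - 3 ^ n * J = int p ^ 2 * z"
      using T by (auto simp: cong_iff_dvd_diff)
    then have "of_int (T - 3 ^ n * J) = (of_int (int p ^ 2 * z) :: rat)" by simp
    \<comment> \<open>\<open>3 ^ n\<close> is a \<open>p\<close>-adic unit, so dividing by it keeps
      the quotient \<open>z / 3 ^ n\<close> integral.\<close>
    then have "of_int T / 3 ^ n - of_int J = of_nat p ^ 2 * (of_int z / 3 ^ n :: rat)"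
      by (simp add: field_simps)
    then show ?thesis
      unfolding padic_cong_def sum using int quot by blast
  qed
  ultimately show ?thesis unfolding S1[symmetric] n_def J_def by blast
qed

end
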